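(* Let $a,b,c,d,e\in\mathbb{Q}$ with $a\neq 0$ and $d\neq 0$, and for $n\in\mathbb{Z}$ put $$w_n=(an^2+bn+c)F_n+(dn+e)F_{n-1}.$$ Then $(w_n)$ is an integer sequence (i.e. $w_n\in\mathbb{Z}$ for all $n$) if and only if $e\in\mathbb{Z}$ and there exist integers $z_1,z_2,z_3,z_4$ such that $$\begin{aligned} a&=\frac{2z_1-z_2-2z_3+z_4}{10},\\ b&=\frac{-56z_1-7z_2+66z_3-23z_4}{50},\\ c&=\frac{48z_1+6z_2-28z_3+9z_4}{25},\\ d&=\frac{-6z_1+18z_2-9z_3+2z_4}{25}. \end{aligned}$$
   Context: $(F_n)$ is the Fibonacci sequence: $F_0=0$, $F_1=1$, $F_n=F_{n-1}+F_{n-2}$, extended to negative indices by the same recurrence, so that $F_{-n}=(-1)^{n+1}F_n$ (in particular $F_{-1}=1$). *)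

theory Defs
  imports Complex_Main "HOL-Number_Theory.Fib"
begin

text \<open>
  Fibonacci numbers with integer index. The library function \<open>fib\<close> only has natural-number
  indices; below zero we use \<open>F(-n) = (-1)^(n+1) F(n)\<close>. The lemmas that follow
  confirm that this is the unique extension satisfying the Fibonacci recurrence on all integers.
\<close>

definition fibz :: "int \<Rightarrow> int" where
  "fibz n = (if 0 \<le> n then int (fib (nat n))
             else (- 1) ^ (nat (- n) + 1) * int (fib (nat (- n))))"

lemma fibz_0: "fibz 0 = 0"
  and fibz_1: "fibz 1 = 1"
  and fibz_minus_1: "fibz (- 1) = 1"
  by (simp_all add: fibz_def)

lemma fibz_of_nat: "fibz (int n) = int (fib n)"
  by (simp add: fibz_def)

lemma fibz_uminus: "fibz (- int n) = (- 1) ^ (n + 1) * fibz (int n)"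
  by (cases "n = 0") (simp_all add: fibz_def)

lemma fibz_rec: "fibz n = fibz (n - 1) + fibz (n - 2)"
proof -
  consider (ge) k where "n = int (k + 2)" | (one) "n = 1" | (le) k where "n = - int k"
  proof (cases "n \<ge> 2")
    case True
    then have "n = int (nat (n - 2) + 2)" by simp
    then show ?thesis by (rule that(1))
  next
    case False
    show ?thesis
    proof (cases "n = 1")
      case True
      then show ?thesis by (rule that(2))
    next
      case n1: False
      with False have "n = - int (nat (- n))" by simp
      then show ?thesis by (rule that(3))
    qed
  qed
  then show ?thesis
  proof cases
    case ge
    have "n - 1 = int (Suc k)" "n - 2 = int k" using ge by simp_all
    then show ?thesis by (simp only: ge fibz_of_nat) simp
  next
    case one
    then show ?thesis by (simp add: fibz_def)
  next
    case le
    have "n - 1 = - int (Suc k)" "n - 2 = - int (Suc (Suc k))" using le by simp_all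
    then show ?thesis by (simp only: le fibz_uminus fibz_of_nat) (simp add: algebra_simps)
  qed
qed

lemma fibz_unique:
  fixes f :: "int \<Rightarrow> int"
  assumes "f 0 = 0" "f 1 = 1" and rec: "\<And>n. f n = f (n - 1) + f (n - 2)"
  shows "f = fibz"
proof
  fix n
  have "f m = fibz m \<and> f (m + 1) = fibz (m + 1)" for m
  proof (induction m rule: int_induct[where k = 0])
    case base
    show ?case using assms(1,2) by (simp add: fibz_0 fibz_1)
  next
    case (step1 i)
    moreover have "i + 2 - 1 = i + 1" "i + 2 - 2 = i" "i + 1 + 1 = i + 2" by simp_all
    ultimately show ?case using rec[of "i + 2"] fibz_rec[of "i + 2"] by metis
  next
    case (step2 i)
    have arith: "i + 1 - 1 = i" "i + 1 - 2 = i - 1" "i - 1 + 1 = i" by simp_all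
    have "f (i + 1) = f i + f (i - 1)" "fibz (i + 1) = fibz i + fibz (i - 1)"
      using rec[of "i + 1"] fibz_rec[of "i + 1"] by (simp_all only: arith)
    then show ?case using step2.IH unfolding arith by linarith
  qed
  then show "f n = fibz n" by (rule conjunct1)
qed

end

theory Submission
  imports Defs
begin

text \<open>
  The sequence \<open>w\<close> is annihilated by \<open>(x^2 - x - 1)^3\<close>, whose leading and constant coefficients are
  units, so it is integral as soon as six consecutive terms are. Now \<open>w 0 = e\<close>, and
  \<open>z k = w k - e F(k - 1)\<close> for \<open>k = 1, \<dots>, 4\<close> is a linear system whose unique solution for
  \<open>a, b, c, d\<close> is the displayed one. For the sixth term, that solution yields
  \<open>w 5 = 3 z1 - 4 z2 - 3 z3 + 4 z4 + 3 e\<close>, which is again integral.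
\<close>

definition quad_fib :: "rat \<Rightarrow> rat \<Rightarrow> rat \<Rightarrow> rat \<Rightarrow> rat \<Rightarrow> int \<Rightarrow> rat" where
  "quad_fib a b c d e n = (a * of_int n ^ 2 + b * of_int n + c) * of_int (fibz n)
     + (d * of_int n + e) * of_int (fibz (n - 1))"

text \<open>The coefficients come from
  \<open>(x^2 - x - 1)^3 = x^6 - 3 x^5 + 5 x^3 - 3 x - 1\<close>: a quadratic polynomial times a
  Fibonacci solution is killed by the cube.\<close>

lemma quad_fib_rec:
  "quad_fib a b c d e (n + 6) = 3 * quad_fib a b c d e (n + 5) - 5 * quad_fib a b c d e (n + 3)
     + 3 * quad_fib a b c d e (n + 1) + quad_fib a b c d e n"
proof -
  \<comment> \<open>These reduce every Fibonacci value to \<open>fibz n\<close> and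
    \<open>fibz (n - 1)\<close>, leaving a polynomial identity in \<open>n\<close> and the
    parameters.\<close>
  have f: "fibz (n + 1) = fibz n + fibz (n - 1)" "fibz (n + 2) = fibz (n + 1) + fibz n"
    "fibz (n + 3) = fibz (n + 2) + fibz (n + 1)" "fibz (n + 4) = fibz (n + 3) + fibz (n + 2)"
    "fibz (n + 5) = fibz (n + 4) + fibz (n + 3)" "fibz (n + 6) = fibz (n + 5) + fibz (n + 4)"
    using fibz_rec[of "n + 1"] fibz_rec[of "n + 2"] fibz_rec[of "n + 3"] fibz_rec[of "n + 4"]
      fibz_rec[of "n + 5"] fibz_rec[of "n + 6"]
    by (simp_all add: algebra_simps)
  have "n + 1 - 1 = n" "n + 3 - 1 = n + 2" "n + 5 - 1 = n + 4" "n + 6 - 1 = n + 5"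
    by simp_all
  then show ?thesis
    unfolding quad_fib_def
    by (simp only: f of_int_add) (simp add: algebra_simps power2_eq_square)
qed

text \<open>A window of six consecutive integral terms can be shifted by one in either direction, so
  induction from 0 reaches all integers.\<close>

lemma Ints_of_rec6:
  fixes u :: "int \<Rightarrow> rat"
  assumes rec: "\<And>n. u (n + 6) = 3 * u (n + 5) - 5 * u (n + 3) + 3 * u (n + 1) + u n"
    and init: "u 0 \<in> \<int>" "u 1 \<in> \<int>" "u 2 \<in> \<int>" "u 3 \<in> \<int>" "u 4 \<in> \<int>" "u 5 \<in> \<int>"
  shows "u n \<in> \<int>"
proof -
  have "u n \<in> \<int> \<and> u (n + 1) \<in> \<int> \<and> u (n + 2) \<in> \<int> \<and> u (n + 3) \<in> \<int> \<and> u (n + 4) \<in> \<int> \<and> u (n + 5) \<in> \<int>"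
  proof (induction n rule: int_induct[where k = 0])
    case base
    show ?case using init by simp
  next
    case (step1 i)
    then have "u (i + 6) \<in> \<int>"
      unfolding rec by (auto intro!: Ints_add Ints_diff Ints_mult)
    with step1.IH show ?case by (simp add: add.assoc)
  next
    case (step2 i)
    \<comment> \<open>The recurrence solved for its lowest term, whose coefficient is 1, so going
      backwards needs no division.\<close>
    have "u (i - 1) = u (i + 5) - 3 * u (i + 4) + 5 * u (i + 2) - 3 * u i"
      using rec[of "i - 1"] by (simp add: algebra_simps)
    also have "\<dots> \<in> \<int>"
      using step2.IH by (auto intro!: Ints_add Ints_diff Ints_mult)
    finally have "u (i - 1) \<in> \<int>" .
    moreover have "i - 1 + 1 = i" "i - 1 + 2 = i + 1" "i - 1 + 3 = i + 2" "i - 1 + 4 = i + 3"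
      "i - 1 + 5 = i + 4" by simp_all
    ultimately show ?case using step2.IH by metis
  qed
  then show ?thesis by simp
qed

theorem theorem3:
  fixes a b c d e :: rat and w :: "int \<Rightarrow> rat"
  assumes "a \<noteq> 0" and "d \<noteq> 0"
    and "\<And>n. w n = (a * of_int n ^ 2 + b * of_int n + c) * of_int (fibz n)
                    + (d * of_int n + e) * of_int (fibz (n - 1))"
  shows "(\<forall>n. w n \<in> \<int>) \<longleftrightarrow>
    e \<in> \<int> \<and>
    (\<exists>z1 z2 z3 z4 :: int.
        a = of_int (2 * z1 - z2 - 2 * z3 + z4) / 10 \<and>
        b = of_int (- 56 * z1 - 7 * z2 + 66 * z3 - 23 * z4) / 50 \<and>
        c = of_int (48 * z1 + 6 * z2 - 28 * z3 + 9 * z4) / 25 \<and>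
        d = of_int (- 6 * z1 + 18 * z2 - 9 * z3 + 2 * z4) / 25)"
proof -
  have w: "w = quad_fib a b c d e"
    using assms(3) by (simp add: fun_eq_iff quad_fib_def)
  have f: "fibz 2 = 1" "fibz 3 = 2" "fibz 4 = 3" "fibz 5 = 5"
    by (simp_all add: fibz_def numeral_eq_Suc)
  have w0: "w 0 = e" and w1: "w 1 = a + b + c" and w2: "w 2 = 4 * a + 2 * b + c + 2 * d + e"
    and w3: "w 3 = 18 * a + 6 * b + 2 * c + 3 * d + e"
    and w4: "w 4 = 48 * a + 12 * b + 3 * c + 8 * d + 2 * e"
    and w5: "w 5 = 125 * a + 25 * b + 5 * c + 15 * d + 3 * e"
    unfolding w quad_fib_def by (simp_all add: f fibz_0 fibz_1 fibz_minus_1)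
  show ?thesis
  proof
    assume int: "\<forall>n. w n \<in> \<int>"
    then have e: "e \<in> \<int>" using w0 by metis
    \<comment> \<open>The multiples of \<open>e\<close> removed are F(0), F(1), F(2), F(3) = 0, 1,
      1, 2.\<close>
    have "w 1 \<in> \<int>" "w 2 - e \<in> \<int>" "w 3 - e \<in> \<int>" "w 4 - 2 * e \<in> \<int>"
      using int e by (auto intro!: Ints_diff Ints_mult)
    then obtain z1 z2 z3 z4 where "w 1 = of_int z1" "w 2 - e = of_int z2"
      "w 3 - e = of_int z3" "w 4 - 2 * e = of_int z4"
      by (auto elim!: Ints_cases)
    then have z: "of_int z1 = a + b + c" "of_int z2 = 4 * a + 2 * b + c + 2 * d"
      "of_int z3 = 18 * a + 6 * b + 2 * c + 3 * d" "of_int z4 = 48 * a + 12 * b + 3 * c + 8 * d"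
      by (simp_all add: w1 w2 w3 w4)
    show "e \<in> \<int> \<and> (\<exists>z1 z2 z3 z4 :: int.
        a = of_int (2 * z1 - z2 - 2 * z3 + z4) / 10 \<and>
        b = of_int (- 56 * z1 - 7 * z2 + 66 * z3 - 23 * z4) / 50 \<and>
        c = of_int (48 * z1 + 6 * z2 - 28 * z3 + 9 * z4) / 25 \<and>
        d = of_int (- 6 * z1 + 18 * z2 - 9 * z3 + 2 * z4) / 25)"
      \<comment> \<open>Substituting the linear forms \<open>z\<close> into the claimed formulas
        verifies the inverse of the 4 by 4 system directly.\<close>
      by (intro conjI e exI[of _ z1] exI[of _ z2] exI[of _ z3] exI[of _ z4])
        (simp_all add: z field_simps)
  next
    assume "e \<in> \<int> \<and> (\<exists>z1 z2 z3 z4 :: int.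
        a = of_int (2 * z1 - z2 - 2 * z3 + z4) / 10 \<and>
        b = of_int (- 56 * z1 - 7 * z2 + 66 * z3 - 23 * z4) / 50 \<and>
        c = of_int (48 * z1 + 6 * z2 - 28 * z3 + 9 * z4) / 25 \<and>
        d = of_int (- 6 * z1 + 18 * z2 - 9 * z3 + 2 * z4) / 25)"
    then obtain m z1 z2 z3 z4 where e: "e = of_int m" and
      abcd: "a = of_int (2 * z1 - z2 - 2 * z3 + z4) / 10"
        "b = of_int (- 56 * z1 - 7 * z2 + 66 * z3 - 23 * z4) / 50"
        "c = of_int (48 * z1 + 6 * z2 - 28 * z3 + 9 * z4) / 25"
        "d = of_int (- 6 * z1 + 18 * z2 - 9 * z3 + 2 * z4) / 25"
      by (auto elim!: Ints_cases)
    \<comment> \<open>The denominators 10, 25 and 50 cancel in all six values; \<open>m\<close>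
      enters with coefficients F(-1), ..., F(4) = 1, 0, 1, 1, 2, 3.\<close>
    have "w 0 = of_int m" "w 1 = of_int z1" "w 2 = of_int (z2 + m)" "w 3 = of_int (z3 + m)"
      "w 4 = of_int (z4 + 2 * m)" "w 5 = of_int (3 * z1 - 4 * z2 - 3 * z3 + 4 * z4 + 3 * m)"
      unfolding w0 w1 w2 w3 w4 w5 e abcd by (simp_all add: field_simps)
    then show "\<forall>n. w n \<in> \<int>"
      using Ints_of_rec6[of w] quad_fib_rec[of a b c d e] unfolding w by (metis Ints_of_int)
  qed
qed

end
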